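(* Let $a$ and $b$ be nonnegative real parameters with $a\neq b$. Let $m$ be a positive integer and let $x\in[a,b]$. Let $k$, $l$ and $n$ be nonnegative integers with $n\geq k$. Then $$\frac{d^{l}\mathbb{Y}_{k}^{n}(x;a,b,m)}{dx^{l}}=\sum_{j=0}^{l}(-1)^{l-j}\binom{n}{n-l,\;l-j,\;j}\frac{l!}{(b-a)^{j}}\,\mathbb{Y}_{k-j}^{n-l}(x;a,b,m-j),$$ where $\binom{n}{p,q,r}=\frac{n!}{p!\,q!\,r!}$ with $n=p+q+r$.
   Context: Here $[a,b]=\{x\in\mathbb{R}: a\le x\le b\}$ (so $a<b$). For an integer $m$ and a nonnegative integer $k$, put $$f_{\mathbb{Y},k}(x,t;a,b,m)=\frac{t^{k}(x-a)^{k}e^{(b-x)t}}{(b-a)^{m}\,k!}\qquad(t\in\mathbb{C}),$$ and define $\mathbb{Y}_{k}^{n}(x;a,b,m)$, $n=0,1,2,\dots$, by $$f_{\mathbb{Y},k}(x,t;a,b,m)=\sum_{n=0}^{\infty}\mathbb{Y}_{k}^{n}(x;a,b,m)\frac{t^{n}}{n!}.$$ Thus $\mathbb{Y}_k^n(x;a,b,m)=0$ when $0\le n<k$; it is a polynomial in $x$, and the derivative is the derivative of this polynomial. Conventions: $\mathbb{Y}_k^n=0$ when $k<0$ or $n<0$; the multinomial coefficient $\binom{n}{p,q,r}$ is $0$ if one of $p,q,r$ is negative; $0^0=1$. *)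

theory Defs
  imports "HOL-Complex_Analysis.Complex_Analysis"
begin

definition gen_fun :: "nat \<Rightarrow> real \<Rightarrow> complex \<Rightarrow> real \<Rightarrow> real \<Rightarrow> int \<Rightarrow> complex" where
  "gen_fun k x t a b m =
     t ^ k * of_real (x - a) ^ k * exp (of_real (b - x) * t) / (of_real (b - a) powi m * fact k)"

definition is_egf_seq :: "(nat \<Rightarrow> real) \<Rightarrow> nat \<Rightarrow> real \<Rightarrow> real \<Rightarrow> real \<Rightarrow> int \<Rightarrow> bool" where
  "is_egf_seq c k x a b m \<longleftrightarrow>
     (\<forall>t :: complex. (\<lambda>n. of_real (c n) * (t ^ n / fact n)) sums gen_fun k x t a b m)"

lemma is_egf_seq_closed_form:
  "is_egf_seq (\<lambda>n. of_nat (n choose k) * (x - a) ^ k * (b - x) ^ (n - k) / (b - a) powi m)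
     k x a b m"
  unfolding is_egf_seq_def
proof
  fix t :: complex
  define C where "C = t ^ k * of_real (x - a) ^ k / (of_real (b - a) powi m * fact k)"
  define g where "g = (\<lambda>n. of_real (real (n choose k) * (x - a) ^ k * (b - x) ^ (n - k)
                          / (b - a) powi m) * (t ^ n / fact n))"
  have e: "(\<lambda>n. C * ((of_real (b - x) * t) ^ n /\<^sub>R fact n)) sums
          (C * exp (of_real (b - x) * t))"
    by (intro sums_mult exp_converges)
  have s: "g (n + k) = C * ((of_real (b - x) * t) ^ n /\<^sub>R fact n)" for n
  proof -
    have "real (n + k choose k) = fact (n + k) / (fact k * fact n)"
      by (subst binomial_fact) auto
    hence "(of_nat (n + k choose k) :: complex) = fact (n + k) / (fact k * fact n)"
      by (metis of_real_of_nat_eq of_real_divide of_real_mult of_real_fact)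
    hence "g (n + k) = fact (n + k) / (fact k * fact n) * of_real (x - a) ^ k * of_real (b - x) ^ n
             / of_real (b - a) powi m * (t ^ (n + k) / fact (n + k))"
      by (simp add: g_def del: of_real_diff)
    also have "\<dots> = C * ((of_real (b - x) * t) ^ n /\<^sub>R fact n)"
      by (cases "complex_of_real (b - a) powi m = 0")
        (simp_all add: C_def field_simps scaleR_conv_of_real power_add power_mult_distrib
                  del: of_real_diff)
    finally show ?thesis .
  qed
  have "(\<lambda>n. g (n + k)) sums (C * exp (of_real (b - x) * t))"
    using e by (simp only: s)
  moreover have "(\<Sum>n<k. g n) = 0"
    by (intro sum.neutral) (auto simp: g_def)
  ultimately have "g sums (C * exp (of_real (b - x) * t))"
    by (simp add: sums_iff_shift)
  thus "g sums gen_fun k x t a b m"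
    by (simp add: C_def gen_fun_def)
qed

lemma is_egf_seq_unique:
  assumes "is_egf_seq c k x a b m" "is_egf_seq d k x a b m"
  shows "c = d"
proof
  fix n
  have A: "(\<lambda>t. gen_fun k x t a b m) has_fps_expansion
           Abs_fps (\<lambda>n. complex_of_real (c n) / fact n)" if "is_egf_seq c k x a b m" for c
    by (rule has_fps_expansionI) (use that in \<open>auto simp: is_egf_seq_def\<close>)
  show "c n = d n"
    using fps_expansion_unique_complex[OF A[OF assms(1)] A[OF assms(2)]]
    by (simp add: fps_eq_iff)
qed

lemma is_egf_seq_ex1: "\<exists>!c. is_egf_seq c k x a b m"
  using is_egf_seq_closed_form is_egf_seq_unique by blast

definition Y_basis :: "int \<Rightarrow> int \<Rightarrow> real \<Rightarrow> real \<Rightarrow> real \<Rightarrow> int \<Rightarrow> real" where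
  "Y_basis k n x a b m =
     (if k < 0 \<or> n < 0 then 0 else (THE c. is_egf_seq c (nat k) x a b m) (nat n))"

text \<open>
  As a function of \<open>x\<close> on the whole real line, \<open>Y_basis k n x a b m\<close> is a polynomial. Hence its
  iterated derivative \<^term>\<open>deriv ^^ l\<close> is the derivative of that polynomial, also at the
  endpoints of \<open>[a, b]\<close>.
\<close>

lemma Y_basis_polynomial: "\<exists>p. \<forall>x. Y_basis k n x a b m = poly p x"
proof (cases "k < 0 \<or> n < 0")
  case True
  thus ?thesis by (intro exI[of _ 0]) (auto simp: Y_basis_def)
next
  case False
  let ?p = "smult (of_nat (nat n choose nat k) / (b - a) powi m)
              ([:-a, 1:] ^ nat k * [:b, -1:] ^ (nat n - nat k))"
  have "Y_basis k n x a b m = poly ?p x" for x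
  proof -
    have "(THE c. is_egf_seq c (nat k) x a b m) =
          (\<lambda>n. of_nat (n choose nat k) * (x - a) ^ nat k * (b - x) ^ (n - nat k) / (b - a) powi m)"
      using is_egf_seq_closed_form is_egf_seq_unique by blast
    thus ?thesis
      using False by (simp add: Y_basis_def)
  qed
  thus ?thesis by blast
qed

lemma higher_deriv_poly: "(deriv ^^ l) (poly p) = poly ((pderiv ^^ l) (p :: real poly))"
proof (induction l)
  case (Suc l)
  have "deriv (poly q) = poly (pderiv q)" for q :: "real poly"
    by (intro ext DERIV_imp_deriv poly_DERIV)
  thus ?case by (simp add: Suc)
qed simp

text \<open>Only meaningful for \<open>n = p + q + r\<close>.\<close>

definition trinomial :: "int \<Rightarrow> int \<Rightarrow> int \<Rightarrow> int \<Rightarrow> real" where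
  "trinomial n p q r =
     (if p < 0 \<or> q < 0 \<or> r < 0 then 0
      else fact (nat n) / (fact (nat p) * fact (nat q) * fact (nat r)))"

end

theory Submission
  imports Defs
begin

text \<open>
  Differentiating the generating function \<open>t\<^sup>k (x - a)\<^sup>k exp ((b - x) t) / ((b - a)\<^sup>m k!)\<close> in \<open>x\<close>
  either lowers the power of \<open>x - a\<close> or brings down a factor \<open>-t\<close> from the exponential. In both
  cases a factor \<open>t\<close> appears, which turns the coefficient of index \<open>n\<close> into \<open>n\<close> times the one of
  index \<open>n - 1\<close>. Writing \<open>S\<close> for the shift \<open>(k, m) \<mapsto> (k - 1, m - 1)\<close>, the derivative therefore
  acts as \<open>n\<close> times the operator \<open>S / (b - a) - 1\<close> on the family with index \<open>n - 1\<close>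
  (lemma \<open>Y_basis_has_derivative\<close>).

  Since \<open>S\<close> commutes with scalars, the \<open>l\<close>-th derivative is the falling factorial
  \<open>n (n - 1) \<cdots> (n - l + 1)\<close> times the binomial expansion of \<open>(S / (b - a) - 1)\<^sup>l\<close>; the induction
  step of lemma \<open>higher_deriv_Y_basis\<close> is Pascal's rule. The falling factorial times
  \<open>l choose j\<close> equals the trinomial coefficient times \<open>l!\<close>, which is the formula of the theorem.
\<close>

lemma Y_basis_nat:
  "Y_basis (int k) (int n) x a b m =
     of_nat (n choose k) * (x - a) ^ k * (b - x) ^ (n - k) / (b - a) powi m"
proof -
  have "(THE c. is_egf_seq c k x a b m) =
        (\<lambda>n. of_nat (n choose k) * (x - a) ^ k * (b - x) ^ (n - k) / (b - a) powi m)"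
    using is_egf_seq_closed_form is_egf_seq_unique by blast
  thus ?thesis by (simp add: Y_basis_def)
qed

lemma Y_basis_neg: "k < 0 \<or> n < 0 \<Longrightarrow> Y_basis k n x a b m = 0"
  by (simp add: Y_basis_def)

text \<open>
  Stated for all integers \<open>k\<close> and \<open>n\<close>: iterating the rule pushes the indices below zero, and the
  convention that the functions vanish there makes the rule remain true, so the iteration needs no
  case distinctions.
\<close>

lemma Y_basis_has_derivative:
  assumes "a \<noteq> b"
  shows "((\<lambda>y. Y_basis k n y a b m) has_real_derivative
           of_int n * (Y_basis (k - 1) (n - 1) x a b (m - 1) / (b - a) - Y_basis k (n - 1) x a b m))
         (at x)"
proof -
  consider "k < 0 \<or> n < 0" | "k \<ge> 0" "n = 0" | N where "k = 0" "n = int (Suc N)"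
    | K N where "k = int (Suc K)" "n = int (Suc N)"
    by (metis linorder_not_le nat_0_le not0_implies_Suc of_nat_0)
  thus ?thesis
  proof cases
    case 1
    thus ?thesis by (auto simp: Y_basis_neg)
  next
    case 2
    then obtain K where "k = int K" by (metis nonneg_int_cases)
    hence eq: "(\<lambda>y. Y_basis k n y a b m) = (\<lambda>y. of_nat (0 choose K) / (b - a) powi m)"
      using 2 Y_basis_nat[of K 0] by (cases K) auto
    show ?thesis unfolding eq by (simp add: 2)
  next
    case (3 N)
    have eq: "(\<lambda>y. Y_basis k n y a b m) = (\<lambda>y. (b - y) ^ Suc N / (b - a) powi m)"
      using Y_basis_nat[of 0 "Suc N"] 3 by simp
    have "Y_basis k (n - 1) x a b m = (b - x) ^ N / (b - a) powi m"
      using Y_basis_nat[of 0 N] 3 by simp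
    moreover have "Y_basis (k - 1) (n - 1) x a b (m - 1) = 0"
      using 3 by (simp add: Y_basis_neg)
    ultimately have rhs: "of_int n * (Y_basis (k - 1) (n - 1) x a b (m - 1) / (b - a)
          - Y_basis k (n - 1) x a b m) = - (real (Suc N) * (b - x) ^ N / (b - a) powi m)"
      using 3(2) by simp
    have "((\<lambda>y. (b - y) ^ Suc N / (b - a) powi m) has_real_derivative
        - (real (Suc N) * (b - x) ^ N / (b - a) powi m)) (at x)"
      using assms by (auto intro!: derivative_eq_intros simp del: power_Suc of_nat_Suc)
    thus ?thesis unfolding eq rhs .
  next
    case (4 K N)
    define P where "P = (b - a) powi m"
    have eq: "(\<lambda>y. Y_basis k n y a b m) =
        (\<lambda>y. of_nat (Suc N choose Suc K) * (y - a) ^ Suc K * (b - y) ^ (N - K) / P)"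
      using Y_basis_nat[of "Suc K" "Suc N"] 4 by (simp add: P_def)
    have "Y_basis (k - 1) (n - 1) x a b (m - 1) / (b - a) =
        of_nat (N choose K) * (x - a) ^ K * (b - x) ^ (N - K) / P"
      using Y_basis_nat[of K N] 4 assms by (simp add: P_def power_int_diff)
    moreover have "Y_basis k (n - 1) x a b m =
        of_nat (N choose Suc K) * (x - a) ^ Suc K * (b - x) ^ (N - Suc K) / P"
      using Y_basis_nat[of "Suc K" N] 4 by (simp add: P_def)
    moreover have "real (Suc N) * real (N choose K) = real (Suc K) * real (Suc N choose Suc K)"
      using binomial_absorption[of K "Suc N"] by (metis diff_Suc_1 of_nat_mult)
    moreover have "real (Suc N) * real (N choose Suc K) = real (N - K) * real (Suc N choose Suc K)"
      using binomial_absorb_comp[of "Suc N" "Suc K"] by (metis diff_Suc_1 diff_Suc_Suc of_nat_mult)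
    ultimately have rhs: "of_int n * (Y_basis (k - 1) (n - 1) x a b (m - 1) / (b - a)
          - Y_basis k (n - 1) x a b m) =
        real (Suc K) * real (Suc N choose Suc K) * ((x - a) ^ K * (b - x) ^ (N - K)) / P
        - real (N - K) * real (Suc N choose Suc K) * ((x - a) ^ Suc K * (b - x) ^ (N - Suc K)) / P"
      using 4(2) by (simp only: of_int_of_nat_eq right_diff_distrib times_divide_eq_right
        mult.assoc[symmetric])
    have "((\<lambda>y. of_nat (Suc N choose Suc K) * (y - a) ^ Suc K * (b - y) ^ (N - K) / P)
        has_real_derivative
          of_nat (Suc N choose Suc K) * (real (Suc K) * (x - a) ^ K * (b - x) ^ (N - K)
            - real (N - K) * (x - a) ^ Suc K * (b - x) ^ (N - Suc K)) / P) (at x)"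
      using assms
      by (auto intro!: derivative_eq_intros simp: P_def field_simps
        simp del: power_Suc of_nat_Suc binomial_Suc_Suc)
    thus ?thesis unfolding eq rhs by (simp only: right_diff_distrib diff_divide_distrib mult_ac)
  qed
qed

lemma sum_choose_Suc:
  fixes h :: "nat \<Rightarrow> 'a :: comm_semiring_1"
  shows "(\<Sum>j\<le>Suc l. of_nat (Suc l choose j) * h j) =
         (\<Sum>j\<le>l. of_nat (l choose j) * (h j + h (Suc j)))"
proof -
  have "(\<Sum>j\<le>Suc l. of_nat (Suc l choose j) * h j) =
        h 0 + (\<Sum>j\<le>l. of_nat (l choose Suc j) * h (Suc j)) + (\<Sum>j\<le>l. of_nat (l choose j) * h (Suc j))"
    by (subst sum.atMost_Suc_shift) (simp add: algebra_simps sum.distrib del: sum.atMost_Suc)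
  also have "h 0 + (\<Sum>j\<le>l. of_nat (l choose Suc j) * h (Suc j)) =
      (\<Sum>j\<le>Suc l. of_nat (l choose j) * h j)"
    by (subst sum.atMost_Suc_shift) simp
  also have "\<dots> = (\<Sum>j\<le>l. of_nat (l choose j) * h j)"
    by (simp add: binomial_eq_0)
  finally show ?thesis by (simp add: algebra_simps sum.distrib)
qed

lemma higher_deriv_Y_basis:
  assumes "a \<noteq> b"
  shows "(deriv ^^ l) (\<lambda>y. Y_basis k n y a b m) =
    (\<lambda>x. (\<Prod>i<l. of_int (n - int i)) *
      (\<Sum>j\<le>l. of_nat (l choose j) *
        ((-1) ^ (l - j) / (b - a) ^ j * Y_basis (k - int j) (n - int l) x a b (m - int j))))"
proof (induction l)
  case 0
  show ?case by simp
next
  case (Suc l)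
  show ?case
  proof
    fix x
    define h where "h = (\<lambda>j. (-1) ^ (Suc l - j) / (b - a) ^ j *
      Y_basis (k - int j) (n - int (Suc l)) x a b (m - int j))"
    let ?F = "\<Prod>i<l. real_of_int (n - int i)"
    let ?D = "\<lambda>j. of_int (n - int l) *
      (Y_basis (k - int j - 1) (n - int l - 1) x a b (m - int j - 1) / (b - a)
       - Y_basis (k - int j) (n - int l - 1) x a b (m - int j))"
    have "((\<lambda>x. ?F * (\<Sum>j\<le>l. of_nat (l choose j) *
        ((-1) ^ (l - j) / (b - a) ^ j * Y_basis (k - int j) (n - int l) x a b (m - int j))))
      has_real_derivative
        ?F * (\<Sum>j\<le>l. of_nat (l choose j) * ((-1) ^ (l - j) / (b - a) ^ j * ?D j))) (at x)"
      by (intro DERIV_cmult DERIV_sum Y_basis_has_derivative assms)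
    hence "(deriv ^^ Suc l) (\<lambda>y. Y_basis k n y a b m) x =
        ?F * (\<Sum>j\<le>l. of_nat (l choose j) * ((-1) ^ (l - j) / (b - a) ^ j * ?D j))"
      by (simp add: Suc.IH DERIV_imp_deriv)
    also have "(\<Sum>j\<le>l. of_nat (l choose j) * ((-1) ^ (l - j) / (b - a) ^ j * ?D j)) =
        (\<Sum>j\<le>l. of_int (n - int l) * (of_nat (l choose j) * (h j + h (Suc j))))"
    proof (rule sum.cong[OF refl])
      fix j assume "j \<in> {..l}"
      define u where "u = Y_basis (k - int j - 1) (n - int l - 1) x a b (m - int j - 1)"
      define v where "v = Y_basis (k - int j) (n - int l - 1) x a b (m - int j)"
      have "h j = - ((-1) ^ (l - j) / (b - a) ^ j * v)"
        using \<open>j \<in> {..l}\<close> by (simp add: h_def v_def Suc_diff_le diff_diff_eq add.commute)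
      moreover have "h (Suc j) = (-1) ^ (l - j) / (b - a) ^ j * (u / (b - a))"
        by (simp add: h_def u_def diff_diff_eq add.commute)
      ultimately have "h j + h (Suc j) = (-1) ^ (l - j) / (b - a) ^ j * (u / (b - a) - v)"
        by (simp only: right_diff_distrib)
      thus "of_nat (l choose j) * ((-1) ^ (l - j) / (b - a) ^ j * ?D j) =
          of_int (n - int l) * (of_nat (l choose j) * (h j + h (Suc j)))"
        by (simp only: u_def v_def mult_ac)
    qed
    also have "\<dots> = of_int (n - int l) * (\<Sum>j\<le>Suc l. of_nat (Suc l choose j) * h j)"
      by (simp only: sum_choose_Suc sum_distrib_left)
    finally show "(deriv ^^ Suc l) (\<lambda>y. Y_basis k n y a b m) x =
      (\<Prod>i<Suc l. of_int (n - int i)) * (\<Sum>j\<le>Suc l. of_nat (Suc l choose j) *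
        ((-1) ^ (Suc l - j) / (b - a) ^ j *
          Y_basis (k - int j) (n - int (Suc l)) x a b (m - int j)))"
      by (simp add: h_def mult.assoc del: sum.atMost_Suc binomial_Suc_Suc)
  qed
qed

text \<open>
  For \<open>l > n\<close> both sides vanish: the product contains the factor \<open>n - n\<close>, and the trinomial
  coefficient has a negative entry.
\<close>

lemma falling_factorial_choose_eq_trinomial:
  assumes "j \<le> l"
  shows "(\<Prod>i<l. of_int (int n - int i)) * of_nat (l choose j) =
         trinomial (int n) (int n - int l) (int l - int j) (int j) * fact l"
proof (cases "l \<le> n")
  case True
  have "(\<Prod>i<l. real_of_int (int n - int i)) = fact n / fact (n - l)"
    using True
  proof (induction l)
    case (Suc l)
    hence "n - l = Suc (n - Suc l)" by simp
    hence "(fact (n - l) :: real) = real (n - l) * fact (n - Suc l)"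
      by (metis fact_Suc of_nat_fact of_nat_mult)
    with Suc show ?case by (simp add: of_nat_diff field_simps)
  qed simp
  moreover have "real (l choose j) = fact l / (fact j * fact (l - j))"
    using assms by (rule binomial_fact)
  moreover have "nat (int n - int l) = n - l" "nat (int l - int j) = l - j"
    by simp_all
  ultimately show ?thesis
    using True assms by (simp add: trinomial_def field_simps)
next
  case False
  hence "(\<Prod>i<l. real_of_int (int n - int i)) = 0" by (intro prod_zero) auto
  thus ?thesis using False by (simp add: trinomial_def)
qed

theorem theorem5:
  fixes a b x :: real and m :: int and k l n :: nat
  assumes "0 \<le> a" and "0 \<le> b" and "a \<noteq> b"
    and "0 < m"
    and "x \<in> {a..b}"
    and "k \<le> n"
  shows "(deriv ^^ l) (\<lambda>y. Y_basis (int k) (int n) y a b m) x =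
    (\<Sum>j = 0..l. (-1) ^ (l - j)
        * trinomial (int n) (int n - int l) (int l - int j) (int j)
        * (fact l / (b - a) ^ j)
        * Y_basis (int k - int j) (int n - int l) x a b (m - int j))"
  unfolding higher_deriv_Y_basis[OF \<open>a \<noteq> b\<close>] sum_distrib_left atMost_atLeast0
proof (rule sum.cong[OF refl])
  fix j assume "j \<in> {0..l}"
  let ?c = "(-1) ^ (l - j) / (b - a) ^ j * Y_basis (int k - int j) (int n - int l) x a b (m - int j)"
  have "(\<Prod>i<l. of_int (int n - int i)) * (of_nat (l choose j) * ?c) =
      trinomial (int n) (int n - int l) (int l - int j) (int j) * fact l * ?c"
    using falling_factorial_choose_eq_trinomial[of j l n] \<open>j \<in> {0..l}\<close>
    by (simp only: mult.assoc[symmetric] atLeastAtMost_iff)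
  thus "(\<Prod>i<l. of_int (int n - int i)) * (of_nat (l choose j) * ?c) =
      (-1) ^ (l - j) * trinomial (int n) (int n - int l) (int l - int j) (int j)
        * (fact l / (b - a) ^ j)
        * Y_basis (int k - int j) (int n - int l) x a b (m - int j)"
    by (simp add: mult_ac)
qed

end
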